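(* Let $q,r$ be nonzero real numbers, let $t>0$ be real, and let $(c_n)_{n\ge 0}$ be defined by $c_0=0$, $c_1=t$ and $c_{n+1}=q\,c_n+r\,c_{n-1}$ for $n\ge 1$. Case 1. Suppose $q\ge 3$ and $-1\le r<0$. If $$t^2(-r)^{n-1}\le c_{n+1}-c_{n-1}-1\quad\text{for every positive integer } n,$$ then for every positive integer $n$, $$\left\lfloor\left(\sum_{k=n}^{\infty}\frac{1}{c_k}\right)^{-1}\right\rfloor=c_n-c_{n-1}-1.$$ Case 2. Suppose $q\ge 2$ and $r\ge 0$. If, for every positive integer $n$, $$\begin{cases} t^2(-r)^{n-1}\le c_{n+1}-c_{n-1}-1 & \text{if } n \text{ is odd},\\ t^2(-r)^{n-1}> -c_{n+1}+c_{n-1}-1 & \text{if } n \text{ is even},\end{cases}$$ then for every positive integer $n$, $$\left\lfloor\left(\sum_{k=n}^{\infty}\frac{1}{c_k}\right)^{-1}\right\rfloor=\begin{cases} c_n-c_{n-1}-1 & \text{if } n \text{ is odd and } n\ge 1,\\ c_n-c_{n-1} & \text{if } n \text{ is even and } n\ge 2.\end{cases}$$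
   Context: $\lfloor x\rfloor$ denotes the greatest integer at most $x$.
   Formalization: The floor equation at each n is asserted only when c_n − c_{n−1} is an integer, since otherwise it is false (e.g. q = 7/2, r = −1, t = 1, n = 2, where the claimed floor is 3/2); convergence of the sums is asserted for every n. *)

theory Defs imports Complex_Main
begin

text \<open>
  The sequence \<open>c\<close> takes real values while a floor is an integer, so an equation
  \<open>\<lfloor>x\<rfloor> = c n - c (n - 1) - 1\<close> or \<open>\<lfloor>x\<rfloor> = c n - c (n - 1)\<close> can hold only if
  \<open>c n - c (n - 1)\<close> is an integer, and this does not follow from the other hypotheses:
  for \<open>q = 7/2\<close>, \<open>r = -1\<close>, \<open>t = 1\<close> one has \<open>c 2 - c 1 = 5/2\<close>. The equation at index
  \<open>n\<close> is therefore asserted under the condition \<open>c n - c (n - 1) \<in> \<int>\<close>. Convergence of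
  the tails \<open>\<Sum>k. 1 / c (n + k)\<close> is asserted without it.
\<close>

end

theory Submission imports Defs
begin

text \<open>
  Put \<open>d n = c (n + 1) - c n\<close>. By the Cassini identity
  \<open>c (n + 1)\<^sup>2 - c (n + 2) * c n = t\<^sup>2 * (- r) ^ n\<close>, the difference between
  \<open>1 / c (n + 1)\<close> and the telescoping term \<open>1 / (d n + s) - 1 / (d (n + 1) + s)\<close> has the sign of
  \<open>t\<^sup>2 * (- r) ^ n + s * (d n + d (n + 1)) + s\<^sup>2\<close>. Summing with \<open>s = 0\<close> compares the
  reciprocal of the tail with \<open>d n\<close>, and \<open>s = - 1\<close> or \<open>s = 1\<close> gives the bound on the other side,
  the hypotheses of the theorem being exactly the required signs. For \<open>s = 0\<close> and \<open>r > 0\<close> the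
  signs alternate, and consecutive terms are added in pairs.
\<close>

section \<open>Growth of the sequence and of its differences\<close>

locale growing_recurrence =
  fixes q r t :: real and c :: "nat \<Rightarrow> real"
  assumes t_pos: "t > 0" and c_0: "c 0 = 0" and c_1: "c (Suc 0) = t"
    and rec: "c (Suc (Suc n)) = q * c (Suc n) + r * c n"
    and doubling: "2 * c n \<le> c (Suc n)"
    and convex: "2 * c (Suc n) \<le> c (Suc (Suc n)) + c n"
begin

text \<open>Indices start at 0 here: \<open>d n\<close> belongs to index \<open>n + 1\<close> of the
  theorem, so parities are swapped. \<open>doubling\<close> makes \<open>d\<close> positive,
  \<open>convex\<close> makes it nondecreasing.\<close>

definition d :: "nat \<Rightarrow> real" where
  "d n = c (Suc n) - c n"

text \<open>The recurrence multiplies this determinant by \<open>- r\<close> at each step, and its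
  initial value is \<open>t\<^sup>2\<close> because \<open>c 0 = 0\<close>.\<close>

lemma cassini: "(c (Suc n))\<^sup>2 - c (Suc (Suc n)) * c n = t\<^sup>2 * (- r) ^ n"
proof (induction n)
  case 0
  show ?case by (simp add: c_0 c_1)
next
  case (Suc n)
  have "(c (Suc (Suc n)))\<^sup>2 - c (Suc (Suc (Suc n))) * c (Suc n)
      = - r * ((c (Suc n))\<^sup>2 - c (Suc (Suc n)) * c n)"
    unfolding rec[of "Suc n"] rec[of n] by algebra
  then show ?case by (simp add: Suc.IH)
qed

lemma c_Suc_ge: "t * 2 ^ n \<le> c (Suc n)"
proof (induction n)
  case (Suc n)
  then show ?case using doubling[of "Suc n"] by simp
qed (simp add: c_1)

lemma c_Suc_pos: "c (Suc n) > 0"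
  using c_Suc_ge[of n] t_pos by (smt (verit) mult_pos_pos zero_less_power)

lemma d_ge_half: "c (Suc n) / 2 \<le> d n"
  using doubling[of n] by (simp add: d_def)

lemma d_pos: "d n > 0"
  using d_ge_half[of n] c_Suc_pos[of n] by linarith

lemma d_mono: "m \<le> n \<Longrightarrow> d m \<le> d n"
  by (rule lift_Suc_mono_le[of d]) (use convex in \<open>auto simp: d_def algebra_simps\<close>)

lemma d_at_top: "filterlim d at_top sequentially"
proof (rule filterlim_at_top_mono)
  show "filterlim (\<lambda>n. t / 2 * real n) at_top sequentially"
    using t_pos filterlim_real_sequentially
    by (intro filterlim_tendsto_pos_mult_at_top[OF tendsto_const]) auto
  have "t / 2 * real n \<le> d n" for n
  proof -
    have "t * real n \<le> t * 2 ^ n"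
      using t_pos of_nat_less_two_power[of n] by (intro mult_left_mono) (auto simp: less_imp_le)
    then show ?thesis using c_Suc_ge[of n] d_ge_half[of n] by simp
  qed
  then show "\<forall>\<^sub>F n in sequentially. t / 2 * real n \<le> d n"
    by simp
qed

lemma summable_inverse_tail: "summable (\<lambda>k. 1 / c (Suc n + k))"
proof (rule summable_ratio_test[of "1/2" 0])
  fix k
  have "c (Suc n + k) > 0" "2 * c (Suc n + k) \<le> c (Suc n + Suc k)"
    using c_Suc_pos[of "n + k"] doubling[of "Suc n + k"] by auto
  then show "norm (1 / c (Suc n + Suc k)) \<le> 1 / 2 * norm (1 / c (Suc n + k))"
    by (simp add: field_simps)
qed simp

section \<open>Reciprocal tails and telescoping defects\<close>

definition tail :: "nat \<Rightarrow> real" where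
  "tail n = (\<Sum>k. 1 / c (Suc n + k))"

text \<open>The error of the telescoping term, written as one fraction so that its sign can be read
  off the numerator. It has this meaning once \<open>d n + s > 0\<close>.\<close>

definition defect :: "real \<Rightarrow> nat \<Rightarrow> real" where
  "defect s n = (t\<^sup>2 * (- r) ^ n + s * (d n + d (Suc n)) + s\<^sup>2)
     / (c (Suc n) * (d n + s) * (d (Suc n) + s))"

lemma defect_eq:
  assumes "d n + s > 0"
  shows "defect s n = 1 / c (Suc n) - (1 / (d n + s) - 1 / (d (Suc n) + s))"
proof -
  have pos: "c (Suc n) > 0" "d (Suc n) + s > 0"
    using c_Suc_pos assms d_mono[of n "Suc n"] by auto
  \<comment> \<open>After \<open>cassini\<close> replaces the power, this is a polynomial identity
    in three consecutive terms of \<open>c\<close>.\<close>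
  have "t\<^sup>2 * (- r) ^ n + s * (d n + d (Suc n)) + s\<^sup>2
      = (d n + s) * (d (Suc n) + s) - c (Suc n) * ((d (Suc n) + s) - (d n + s))"
    unfolding cassini[symmetric] d_def by algebra
  then show ?thesis
    unfolding defect_def using pos assms by (simp add: divide_simps)
qed

text \<open>The telescoping part collapses to its first term because \<open>d\<close> tends to
  infinity. Signs of defects thus decide how \<open>tail n\<close> compares with
  \<open>1 / (d n + s)\<close>.\<close>

lemma defect_sums:
  assumes "d n + s > 0"
  shows "(\<lambda>k. defect s (n + k)) sums (tail n - 1 / (d n + s))"
proof -
  have "filterlim (\<lambda>k. d (k + n)) at_top sequentially"
    using filterlim_compose[OF d_at_top filterlim_add_const_nat_at_top] .
  then have "filterlim (\<lambda>k. s + d (k + n)) at_top sequentially"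
    by (rule filterlim_tendsto_add_at_top[OF tendsto_const])
  then have "filterlim (\<lambda>k. d (n + k) + s) at_top sequentially"
    by (simp add: add.commute)
  then have "(\<lambda>k. 1 / (d (n + k) + s)) \<longlonglongrightarrow> 0"
    unfolding inverse_eq_divide[symmetric] by (rule tendsto_inverse_0_at_top)
  then have "(\<lambda>k. 1 / (d (n + k) + s) - 1 / (d (n + Suc k) + s)) sums (1 / (d (n + 0) + s) - 0)"
    by (rule telescope_sums')
  moreover have "(\<lambda>k. 1 / c (Suc n + k)) sums tail n"
    unfolding tail_def using summable_inverse_tail by (rule summable_sums)
  ultimately have "(\<lambda>k. 1 / c (Suc n + k) - (1 / (d (n + k) + s) - 1 / (d (n + Suc k) + s)))
      sums (tail n - 1 / (d n + s))"
    using sums_diff by fastforce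
  moreover have "d (n + k) + s > 0" for k
    using assms d_mono[of n "n + k"] by simp
  ultimately show ?thesis
    by (simp add: defect_eq)
qed

lemma sums_pos:
  fixes f :: "nat \<Rightarrow> real"
  assumes "f sums S" and "\<And>k. f k > 0"
  shows "S > 0"
  using suminf_pos[of f] assms sums_unique[of f S] sums_summable[of f S] by simp

text \<open>Grouping a convergent series into blocks of two keeps its sum. This serves series whose
  terms alternate in sign.\<close>

lemma sums_pos_pairs:
  fixes f :: "nat \<Rightarrow> real"
  assumes "f sums S" and "\<And>k. even k \<Longrightarrow> f k + f (Suc k) > 0"
  shows "S > 0"
proof (rule sums_pos)
  show "(\<lambda>k. sum f {k * 2..<k * 2 + 2}) sums S"
    using assms(1) by (rule sums_group) simp
  show "sum f {k * 2..<k * 2 + 2} > 0" for k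
  proof -
    have "{k * 2..<k * 2 + 2} = {k * 2, Suc (k * 2)}"
      by auto
    then show ?thesis using assms(2)[of "k * 2"] by simp
  qed
qed

lemma defect_pos_iff:
  assumes "d n + s > 0"
  shows "defect s n > 0 \<longleftrightarrow> t\<^sup>2 * (- r) ^ n + s * (d n + d (Suc n)) + s\<^sup>2 > 0"
proof -
  have "d (Suc n) + s > 0"
    using assms d_mono[of n "Suc n"] by simp
  then have "c (Suc n) * (d n + s) * (d (Suc n) + s) > 0"
    using c_Suc_pos assms by simp
  then show ?thesis
    unfolding defect_def by (simp add: zero_less_divide_iff)
qed

section \<open>Bounds on the reciprocal of a tail\<close>

lemma tail_pos: "tail n > 0"
  unfolding tail_def using summable_inverse_tail
  by (rule suminf_pos) (use c_Suc_pos[of "n + _"] in simp)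

lemma inverse_tail_less:
  assumes "d n + s > 0" and "tail n > 1 / (d n + s)"
  shows "inverse (tail n) < d n + s"
  using assms tail_pos[of n] by (simp add: field_simps)

lemma less_inverse_tail:
  assumes "tail n < 1 / d n"
  shows "d n < inverse (tail n)"
  using assms tail_pos[of n] d_pos[of n] by (simp add: field_simps)

text \<open>The shift \<open>s = - 1\<close>: \<open>cond\<close> says that the numerators of the
  defects are nonpositive. It is asked only where \<open>d m > 1\<close>, since for
  \<open>d n \<le> 1\<close> the bound is nonpositive and the tail is positive.\<close>

lemma inverse_tail_ge:
  assumes cond: "\<And>m. m \<ge> n \<Longrightarrow> d m > 1 \<Longrightarrow> t\<^sup>2 * (- r) ^ m \<le> d m + d (Suc m) - 1"
  shows "d n - 1 \<le> inverse (tail n)"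
proof (cases "d n > 1")
  case True
  then have d: "d (n + k) > 1" for k
    using d_mono[of n "n + k"] by simp
  have "defect (- 1) (n + k) \<le> 0" for k
    using cond[of "n + k"] d[of k] defect_pos_iff[of "n + k" "- 1"] by (simp add: not_less[symmetric])
  moreover have "(\<lambda>k. defect (- 1) (n + k)) sums (tail n - 1 / (d n + - 1))"
    using True by (intro defect_sums) simp
  ultimately have "tail n - 1 / (d n + - 1) \<le> 0"
    by (rule sums_le[OF _ _ sums_zero])
  then show ?thesis
    using True tail_pos[of n] by (simp add: field_simps)
next
  case False
  then show ?thesis using tail_pos[of n] by (smt (verit) inverse_positive_iff_positive)
qed

text \<open>Integrality of the left end lets a half-open interval of length one determine the floor;
  \<open>s = 0\<close> and \<open>s = 1\<close> give the two values in the theorem.\<close>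

lemma floor_inverse_tail:
  assumes "d n + s - 1 \<in> \<int>" and "d n + s - 1 \<le> inverse (tail n)" and "inverse (tail n) < d n + s"
  shows "real_of_int \<lfloor>inverse (tail n)\<rfloor> = d n + s - 1"
proof -
  obtain z where z: "d n + s - 1 = real_of_int z"
    using assms(1) by (rule Ints_cases)
  then have "\<lfloor>inverse (tail n)\<rfloor> = z"
    using assms by (intro floor_unique) auto
  then show ?thesis using z by simp
qed

text \<open>For \<open>r < 0\<close> all powers of \<open>- r\<close> are positive, hence so are all
  defects with \<open>s = 0\<close>, which gives the strict upper bound \<open>d n\<close>.\<close>

lemma floor_inverse_tail_negative:
  assumes "r < 0" and "d n \<in> \<int>"
    and cond: "\<And>m. t\<^sup>2 * (- r) ^ m \<le> d m + d (Suc m) - 1"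
  shows "real_of_int \<lfloor>inverse (tail n)\<rfloor> = d n - 1"
proof -
  have "defect 0 (n + k) > 0" for k
    using assms(1) t_pos d_pos by (simp add: defect_pos_iff)
  moreover have "(\<lambda>k. defect 0 (n + k)) sums (tail n - 1 / (d n + 0))"
    using d_pos by (intro defect_sums) simp
  ultimately have "tail n - 1 / (d n + 0) > 0"
    by (rule sums_pos[rotated])
  then show ?thesis
    using floor_inverse_tail[of n 0] inverse_tail_less[of n 0] inverse_tail_ge[of n] d_pos[of n] assms
    by simp
qed

section \<open>Alternating defects for positive \<open>r\<close>\<close>

lemma defect_pair_sign:
  assumes "q \<ge> 2" and "r > 0"
  shows "(- 1) ^ n * (defect 0 n + defect 0 (Suc n)) > 0"
proof -
  have "d (Suc (Suc n)) = q * d (Suc n) + r * d n"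
    by (simp add: d_def rec algebra_simps)
  moreover have "q * d (Suc n) > 0"
    using assms d_pos by simp
  ultimately have "r * d n < d (Suc (Suc n))"
    by simp
  moreover have "c (Suc n) \<le> c (Suc (Suc n))"
    using d_pos[of "Suc n"] by (simp add: d_def)
  ultimately have less: "c (Suc n) * (r * d n) < c (Suc (Suc n)) * d (Suc (Suc n))"
    using assms c_Suc_pos[of n] d_pos[of n] by (intro mult_le_less_imp_less) auto
  \<comment> \<open>The two defects share the factor
    \<open>t\<^sup>2 * (- r) ^ n / d (Suc n)\<close>; the sign of what remains is decided by
    \<open>less\<close>.\<close>
  have "(- 1) ^ n * (defect 0 n + defect 0 (Suc n))
      = t\<^sup>2 * ((- 1) ^ n * (- r) ^ n) / d (Suc n)
        * (1 / (c (Suc n) * d n) - r / (c (Suc (Suc n)) * d (Suc (Suc n))))"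
    by (simp add: defect_def algebra_simps)
  moreover have "(- 1) ^ n * (- r) ^ n = r ^ n"
    by (simp flip: power_mult_distrib)
  moreover have "r / (c (Suc (Suc n)) * d (Suc (Suc n))) < 1 / (c (Suc n) * d n)"
    using less c_Suc_pos d_pos by (simp add: field_simps)
  moreover have "t\<^sup>2 * r ^ n / d (Suc n) > 0"
    using assms t_pos d_pos by simp
  ultimately show ?thesis by (metis diff_gt_0_iff_gt mult_pos_pos)
qed

text \<open>Pairs of defects starting at \<open>n + k\<close> with \<open>k\<close> even all have
  the sign \<open>(- 1) ^ n\<close>, so their sum has it too.\<close>

lemma tail_sign:
  assumes "q \<ge> 2" and "r > 0"
  shows "(- 1) ^ n * (tail n - 1 / d n) > 0"
proof (rule sums_pos_pairs)
  have "(\<lambda>k. defect 0 (n + k)) sums (tail n - 1 / (d n + 0))"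
    using d_pos by (intro defect_sums) simp
  then show "(\<lambda>k. (- 1) ^ n * defect 0 (n + k)) sums ((- 1) ^ n * (tail n - 1 / d n))"
    using sums_mult by fastforce
  show "(- 1) ^ n * defect 0 (n + k) + (- 1) ^ n * defect 0 (n + Suc k) > 0" if "even k" for k
    using that defect_pair_sign[OF assms, of "n + k"] by (simp add: power_add distrib_left)
qed

lemma floor_inverse_tail_even:
  assumes "q \<ge> 2" and "r > 0" and "d n \<in> \<int>" and "even n"
    and cond: "\<And>m. even m \<Longrightarrow> t\<^sup>2 * (- r) ^ m \<le> d m + d (Suc m) - 1"
  shows "real_of_int \<lfloor>inverse (tail n)\<rfloor> = d n - 1"
proof -
  \<comment> \<open>At odd \<open>m\<close>, where \<open>cond\<close> is silent, the left side is
    nonpositive and \<open>d m > 1\<close> makes the right side positive.\<close>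
  have "t\<^sup>2 * (- r) ^ m \<le> d m + d (Suc m) - 1" if "d m > 1" for m
  proof (cases "even m")
    case False
    then have "t\<^sup>2 * (- r) ^ m \<le> 0"
      using assms(2) by (simp add: power_minus_odd)
    then show ?thesis using that d_pos[of "Suc m"] by linarith
  qed (use cond in simp)
  then show ?thesis
    using floor_inverse_tail[of n 0] inverse_tail_less[of n 0] inverse_tail_ge[of n] d_pos[of n]
      tail_sign[of n] assms by simp
qed

text \<open>At odd \<open>n\<close> the sign of the tail error is reversed, so \<open>d n\<close> is
  now the lower bound; the upper bound \<open>d n + 1\<close> comes from the shift
  \<open>s = 1\<close>, whose numerators are positive by \<open>cond\<close> or, at even
  \<open>m\<close>, term by term.\<close>

lemma floor_inverse_tail_odd:
  assumes "q \<ge> 2" and "r > 0" and "d n \<in> \<int>" and "odd n"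
    and cond: "\<And>m. odd m \<Longrightarrow> t\<^sup>2 * (- r) ^ m > - d m - d (Suc m) - 1"
  shows "real_of_int \<lfloor>inverse (tail n)\<rfloor> = d n"
proof -
  have "t\<^sup>2 * (- r) ^ m > - d m - d (Suc m) - 1" for m
  proof (cases "even m")
    case True
    then have "t\<^sup>2 * (- r) ^ m \<ge> 0"
      using assms(2) by simp
    then show ?thesis using d_pos[of m] d_pos[of "Suc m"] by linarith
  qed (use cond in simp)
  then have "defect 1 (n + k) > 0" for k
    using defect_pos_iff[of "n + k" 1] d_pos[of "n + k"] by (smt (verit) one_power2 mult_1)
  moreover have "d n + 1 > 0"
    using d_pos[of n] by simp
  ultimately have "inverse (tail n) < d n + 1"
    using inverse_tail_less[of n 1] sums_pos[OF defect_sums] by simp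
  then show ?thesis
    using floor_inverse_tail[of n 1] less_inverse_tail[of n] tail_sign[of n] assms by simp
qed

end

section \<open>The growth conditions in the two cases\<close>

theorem theorem1p7:
  fixes q r t :: real and c :: "nat \<Rightarrow> real"
  assumes "q \<noteq> 0" and "r \<noteq> 0" and "t > 0"
    and "c 0 = 0" and "c 1 = t"
    and "\<forall>n\<ge>1. c (n + 1) = q * c n + r * c (n - 1)"
  shows
    "(q \<ge> 3 \<and> - 1 \<le> r \<and> r < 0 \<and>
      (\<forall>n\<ge>1. t\<^sup>2 * (- r) ^ (n - 1) \<le> c (n + 1) - c (n - 1) - 1)
      \<longrightarrow>
      (\<forall>n\<ge>1. summable (\<lambda>k. 1 / c (n + k)) \<and>
        (c n - c (n - 1) \<in> \<int> \<longrightarrow>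
          real_of_int \<lfloor>inverse (\<Sum>k. 1 / c (n + k))\<rfloor> = c n - c (n - 1) - 1)))
     \<and>
     (q \<ge> 2 \<and> r \<ge> 0 \<and>
      (\<forall>n\<ge>1.
        (odd n \<longrightarrow> t\<^sup>2 * (- r) ^ (n - 1) \<le> c (n + 1) - c (n - 1) - 1) \<and>
        (even n \<longrightarrow> t\<^sup>2 * (- r) ^ (n - 1) > - c (n + 1) + c (n - 1) - 1))
      \<longrightarrow>
      (\<forall>n\<ge>1. summable (\<lambda>k. 1 / c (n + k)) \<and>
        (c n - c (n - 1) \<in> \<int> \<longrightarrow>
          real_of_int \<lfloor>inverse (\<Sum>k. 1 / c (n + k))\<rfloor> =
            (if odd n then c n - c (n - 1) - 1 else c n - c (n - 1)))))"
proof -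
  have rec: "c (Suc (Suc n)) = q * c (Suc n) + r * c n" for n
    using assms(6) by (auto dest: spec[of _ "Suc n"])
  show ?thesis
  proof (intro conjI impI; elim conjE)
    assume q: "q \<ge> 3" and r: "- 1 \<le> r" "r < 0"
      and cond: "\<forall>n\<ge>1. t\<^sup>2 * (- r) ^ (n - 1) \<le> c (n + 1) - c (n - 1) - 1"
    \<comment> \<open>The term \<open>r * c n\<close> costs at most \<open>c n\<close>, hence at
      most one of the three copies of \<open>c (Suc n)\<close> that \<open>q \<ge> 3\<close>
      provides.\<close>
    have step: "2 * c (Suc n) \<le> c (Suc (Suc n))" if "0 \<le> c n" "c n \<le> c (Suc n)" for n
    proof -
      have "3 * c (Suc n) \<le> q * c (Suc n)" "- 1 * c n \<le> r * c n"
        using q r that by (intro mult_right_mono; simp)+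
      then show ?thesis using that rec[of n] by linarith
    qed
    have doubling: "0 \<le> c n \<and> 2 * c n \<le> c (Suc n)" for n
    proof (induction n)
      case (Suc n)
      then show ?case using step[of n] by linarith
    qed (use assms in simp)
    interpret growing_recurrence q r t c
    proof
      fix n
      have "2 * c (Suc n) \<le> q * c (Suc n)" "- 1 * c n \<le> r * c n"
        using q r doubling[of n] doubling[of "Suc n"] by (intro mult_right_mono; simp)+
      then show "2 * c (Suc n) \<le> c (Suc (Suc n)) + c n"
        using rec[of n] by linarith
    qed (use assms rec doubling in auto)
    \<comment> \<open>The sum \<open>d m + d (Suc m)\<close> telescopes to
      \<open>c (m + 2) - c m\<close>, so this is the hypothesis at index
      \<open>m + 1\<close>.\<close>
    have cond': "t\<^sup>2 * (- r) ^ m \<le> d m + d (Suc m) - 1" for m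
      using cond[rule_format, of "Suc m"] by (simp add: d_def)
    show "\<forall>n\<ge>1. summable (\<lambda>k. 1 / c (n + k)) \<and>
        (c n - c (n - 1) \<in> \<int> \<longrightarrow>
          real_of_int \<lfloor>inverse (\<Sum>k. 1 / c (n + k))\<rfloor> = c n - c (n - 1) - 1)"
    proof (intro allI impI)
      fix n :: nat
      assume "n \<ge> 1"
      then obtain m where n: "n = Suc m" by (cases n) auto
      show "summable (\<lambda>k. 1 / c (n + k)) \<and>
        (c n - c (n - 1) \<in> \<int> \<longrightarrow>
          real_of_int \<lfloor>inverse (\<Sum>k. 1 / c (n + k))\<rfloor> = c n - c (n - 1) - 1)"
        using summable_inverse_tail[of m] floor_inverse_tail_negative[of m] r cond'
        unfolding n tail_def by (simp add: d_def)
    qed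
  next
    assume q: "q \<ge> 2" and "r \<ge> 0"
      and cond: "\<forall>n\<ge>1.
        (odd n \<longrightarrow> t\<^sup>2 * (- r) ^ (n - 1) \<le> c (n + 1) - c (n - 1) - 1) \<and>
        (even n \<longrightarrow> t\<^sup>2 * (- r) ^ (n - 1) > - c (n + 1) + c (n - 1) - 1)"
    then have r: "r > 0" using assms(2) by simp
    \<comment> \<open>Now \<open>r * c n\<close> is nonnegative, so \<open>q \<ge> 2\<close> is
      enough.\<close>
    have step: "2 * c (Suc n) \<le> c (Suc (Suc n))" if "0 \<le> c n" "0 \<le> c (Suc n)" for n
      using that q r rec[of n] mult_right_mono[of 2 q "c (Suc n)"] mult_nonneg_nonneg[of r "c n"]
      by linarith
    have doubling: "0 \<le> c n \<and> 2 * c n \<le> c (Suc n)" for n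
    proof (induction n)
      case (Suc n)
      then show ?case using step[of n] by linarith
    qed (use assms in simp)
    interpret growing_recurrence q r t c
    proof
      show "2 * c (Suc n) \<le> c (Suc (Suc n)) + c n" for n
        using doubling[of n] doubling[of "Suc n"] by linarith
    qed (use assms rec doubling in auto)
    \<comment> \<open>The shift to index \<open>m + 1\<close> turns the hypothesis for odd indices
      into one for even \<open>m\<close>, and conversely below.\<close>
    have even: "t\<^sup>2 * (- r) ^ m \<le> d m + d (Suc m) - 1" if "even m" for m
      using cond[rule_format, of "Suc m"] that by (simp add: d_def)
    have odd: "t\<^sup>2 * (- r) ^ m > - d m - d (Suc m) - 1" if "odd m" for m
      using cond[rule_format, of "Suc m"] that by (simp add: d_def)
    show "\<forall>n\<ge>1. summable (\<lambda>k. 1 / c (n + k)) \<and>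
        (c n - c (n - 1) \<in> \<int> \<longrightarrow>
          real_of_int \<lfloor>inverse (\<Sum>k. 1 / c (n + k))\<rfloor> =
            (if odd n then c n - c (n - 1) - 1 else c n - c (n - 1)))"
    proof (intro allI impI)
      fix n :: nat
      assume "n \<ge> 1"
      then obtain m where n: "n = Suc m" by (cases n) auto
      show "summable (\<lambda>k. 1 / c (n + k)) \<and>
        (c n - c (n - 1) \<in> \<int> \<longrightarrow>
          real_of_int \<lfloor>inverse (\<Sum>k. 1 / c (n + k))\<rfloor> =
            (if odd n then c n - c (n - 1) - 1 else c n - c (n - 1)))"
        using summable_inverse_tail[of m] floor_inverse_tail_even[of m] floor_inverse_tail_odd[of m]
          q r even odd
        unfolding n tail_def by (simp add: d_def)
    qed
  qed
qed

end
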